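(* The Polish group $\mathrm{Isom}(\mathbf{H})$ is minimal: there is no Hausdorff group topology on $\mathrm{Isom}(\mathbf{H})$ strictly coarser than the topology of pointwise convergence on $\mathbf{H}$.
   Context: $\mathcal{H}$ is an infinite-dimensional separable real Hilbert space with Hilbert basis $(e_i)_{i\in\mathbb{N}}$, and $Q(x)=x_0^2-\sum_{i\ge1}x_i^2$ with polarized symmetric bilinear form $(\cdot,\cdot)$. The infinite-dimensional separable hyperbolic space is $\mathbf{H}=\{x\in\mathcal{H}: Q(x)=1,\ x_0>0\}$ with metric $\cosh d(x,y)=(x,y)$. $\mathrm{Isom}(\mathbf{H})$ is its isometry group with the topology of pointwise convergence (the coarsest group topology making all orbit maps $g\mapsto gx$, $x\in\mathbf{H}$, continuous), which is Polish. *)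

theory Defs
  imports "HOL-Analysis.Analysis" "HOL-Algebra.Bij"
begin

text \<open>
  A Hilbert basis indexed by the natural numbers. On a type of sort
  \<open>{real_inner, banach}\<close>, its existence says that the type is an infinite-dimensional
  separable real Hilbert space.
\<close>

definition hilbert_basis :: "(nat \<Rightarrow> 'a::{real_inner, banach}) \<Rightarrow> bool" where
  "hilbert_basis e \<longleftrightarrow>
     (\<forall>i j. e i \<bullet> e j = (if i = j then 1 else 0)) \<and> closure (span (range e)) = UNIV"

definition hyp_Q :: "(nat \<Rightarrow> 'a::{real_inner, banach}) \<Rightarrow> 'a \<Rightarrow> real" where
  "hyp_Q e x = (x \<bullet> e 0)\<^sup>2 - (\<Sum>i. (x \<bullet> e (Suc i))\<^sup>2)"

definition hyp_form :: "(nat \<Rightarrow> 'a::{real_inner, banach}) \<Rightarrow> 'a \<Rightarrow> 'a \<Rightarrow> real" where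
  "hyp_form e x y = (hyp_Q e (x + y) - hyp_Q e x - hyp_Q e y) / 2"

definition hyp_space :: "(nat \<Rightarrow> 'a::{real_inner, banach}) \<Rightarrow> 'a set" where
  "hyp_space e = {x. hyp_Q e x = 1 \<and> x \<bullet> e 0 > 0}"

text \<open>
  The locale \<open>Metric_space\<close> asks for nonnegativity and symmetry of the distance on the whole
  type, hence the value 0 outside the hyperbolic space. On it the form takes values at least 1,
  so the distance is the unique nonnegative real whose \<open>cosh\<close> is the value of the form.
\<close>

definition hyp_dist :: "(nat \<Rightarrow> 'a::{real_inner, banach}) \<Rightarrow> 'a \<Rightarrow> 'a \<Rightarrow> real" where
  "hyp_dist e x y =
     (if x \<in> hyp_space e \<and> y \<in> hyp_space e then arcosh (hyp_form e x y) else 0)"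

text \<open>
  Isometries are the distance-preserving bijections of the hyperbolic space; as in
  \<open>BijGroup\<close>, they are represented by functions that are \<open>undefined\<close> outside of it,
  and the product is composition.
\<close>

definition hyp_Isom :: "(nat \<Rightarrow> 'a::{real_inner, banach}) \<Rightarrow> ('a \<Rightarrow> 'a) monoid" where
  "hyp_Isom e = (BijGroup (hyp_space e))
     \<lparr>carrier := {g \<in> Bij (hyp_space e).
        \<forall>x\<in>hyp_space e. \<forall>y\<in>hyp_space e. hyp_dist e (g x) (g y) = hyp_dist e x y}\<rparr>"

definition hyp_pointwise_topology ::
    "(nat \<Rightarrow> 'a::{real_inner, banach}) \<Rightarrow> ('a \<Rightarrow> 'a) topology" where
  "hyp_pointwise_topology e =
     subtopology
       (product_topology (\<lambda>_. Metric_space.mtopology (hyp_space e) (hyp_dist e)) (hyp_space e))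
       (carrier (hyp_Isom e))"

definition group_topology :: "('g, 'b) monoid_scheme \<Rightarrow> 'g topology \<Rightarrow> bool" where
  "group_topology G T \<longleftrightarrow>
     group G \<and> topspace T = carrier G \<and>
     continuous_map (prod_topology T T) T (\<lambda>(g, h). g \<otimes>\<^bsub>G\<^esub> h) \<and>
     continuous_map T T (\<lambda>g. inv\<^bsub>G\<^esub> g)"

definition strictly_coarser :: "'g topology \<Rightarrow> 'g topology \<Rightarrow> bool" where
  "strictly_coarser S T \<longleftrightarrow> (\<forall>U. openin S U \<longrightarrow> openin T U) \<and> S \<noteq> T"

definition minimal_topological_group :: "('g, 'b) monoid_scheme \<Rightarrow> 'g topology \<Rightarrow> bool" where
  "minimal_topological_group G T \<longleftrightarrow>
     group_topology G T \<and> Hausdorff_space T \<and>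
     \<not> (\<exists>S. group_topology G S \<and> Hausdorff_space S \<and> strictly_coarser S T)"

end

theory Submission
  imports Defs
begin

text \<open>
  Let \<open>S\<close> be a Hausdorff group topology coarser than pointwise convergence, and let \<open>R\<^sub>v\<close> be the
  reflection in a vector \<open>v\<close> with \<open>Q(v) = -1\<close>.

  If \<open>R\<^sub>v\<close> is \<open>S\<close>-close to the identity, then \<open>v\<close> has small zeroth coordinate. Otherwise there is a
  vector \<open>a\<close> in a fixed compact set with \<open>Q(a) = -1\<close> and \<open>(v, a) = 1/2\<close>; the braid relation
  \<open>R\<^sub>a = R\<^sub>v R\<^sub>a R\<^sub>v R\<^sub>a R\<^sub>v\<close> then makes \<open>R\<^sub>a\<close> close to \<open>R\<^sub>a\<^sup>2 = 1\<close>, which compactness and the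
  Hausdorff property exclude.

  An \<open>S\<close>-neighbourhood of the identity is a pointwise neighbourhood, hence contains \<open>R\<^sub>z\<close> for all
  unit vectors \<open>z\<close> orthogonal to \<open>e\<^sub>0, \<dots>, e\<^bsub>n-1\<^esub>\<close>, for some \<open>n\<close>. If \<open>g\<close> is \<open>S\<close>-close to the identity,
  so is \<open>g\<^bsup>-1\<^esup> R\<^sub>z g\<close>, the reflection in \<open>g\<^bsup>-1\<^esup> z\<close>, whose zeroth coordinate is \<open>(z, g e\<^sub>0)\<close>. Thus the
  coordinates of \<open>g e\<^sub>0\<close> from \<open>n\<close> on are small. Conjugating \<open>g\<close> by an isometry that swaps \<open>e\<^sub>j\<close> with
  \<open>e\<^bsub>n+j\<^esub>\<close> for \<open>0 < j < n\<close> shows that the remaining coordinates other than the zeroth are small too,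
  so \<open>g e\<^sub>0\<close> is close to \<open>e\<^sub>0\<close>. By transitivity, \<open>S\<close> makes all orbit maps continuous.
\<close>

section \<open>The isometry group of a metric space\<close>

context Metric_space
begin

text \<open>Phrased for an arbitrary metric space, so that the group and topology facts rest on the
  metric axioms alone. The body mirrors that of \<open>hyp_Isom\<close>, so the later identification
  is a mere unfolding.\<close>

definition isom_group :: "('a \<Rightarrow> 'a) monoid" where
  "isom_group = (BijGroup M)
     \<lparr>carrier := {g \<in> Bij M. \<forall>x\<in>M. \<forall>y\<in>M. d (g x) (g y) = d x y}\<rparr>"

definition pointwise_topology :: "('a \<Rightarrow> 'a) topology" where
  "pointwise_topology =
     subtopology (product_topology (\<lambda>_. mtopology) M) (carrier isom_group)"

text \<open>Preserving distances forces injectivity: points with equal images are at distance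
  0.\<close>

lemma isom_groupI:
  assumes "g \<in> extensional M" "g ` M = M"
    "\<And>x y. x \<in> M \<Longrightarrow> y \<in> M \<Longrightarrow> d (g x) (g y) = d x y"
  shows "g \<in> carrier isom_group"
proof -
  have "inj_on g M"
    using assms by (metis image_eqI inj_onI zero)
  then show ?thesis
    using assms by (auto simp: isom_group_def Bij_def bij_betw_def)
qed

lemma isom_groupD:
  assumes "g \<in> carrier isom_group"
  shows "g \<in> Bij M" "g \<in> extensional M" "g ` M = M"
    "x \<in> M \<Longrightarrow> g x \<in> M" "x \<in> M \<Longrightarrow> y \<in> M \<Longrightarrow> d (g x) (g y) = d x y"
  using assms by (auto simp: isom_group_def Bij_def bij_betw_def)

lemma isom_group_eqI:
  assumes "g \<in> carrier isom_group" "h \<in> carrier isom_group" "\<And>x. x \<in> M \<Longrightarrow> g x = h x"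
  shows "g = h"
  using assms isom_groupD(2) extensionalityI by metis

lemma subgroup_isom_group: "subgroup (carrier isom_group) (BijGroup M)"
proof (rule group.subgroupI[OF group_BijGroup])
  have 1: "carrier isom_group \<subseteq> Bij M"
    by (auto simp: isom_group_def)
  then show "carrier isom_group \<subseteq> carrier (BijGroup M)"
    by (simp add: BijGroup_def)
  have "(\<lambda>x\<in>M. x) \<in> carrier isom_group"
    by (rule isom_groupI) auto
  then show "carrier isom_group \<noteq> {}"
    by blast
  fix g assume g: "g \<in> carrier isom_group"
  then have inv: "inv\<^bsub>BijGroup M\<^esub> g = (\<lambda>x\<in>M. inv_into M g x)"
    using inv_BijGroup 1 by blast
  have bij: "bij_betw g M M"
    using g by (auto simp: isom_group_def Bij_def)
  show "inv\<^bsub>BijGroup M\<^esub> g \<in> carrier isom_group"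
    unfolding inv
  proof (rule isom_groupI)
    show "(\<lambda>x\<in>M. inv_into M g x) ` M = M"
      using bij_betw_inv_into[OF bij] by (auto simp: bij_betw_def)
    fix x y assume xy: "x \<in> M" "y \<in> M"
    then have "inv_into M g x \<in> M" "inv_into M g y \<in> M"
      using bij by (auto simp: bij_betw_def inv_into_into)
    then have "d (inv_into M g x) (inv_into M g y) = d (g (inv_into M g x)) (g (inv_into M g y))"
      using isom_groupD(5)[OF g] by simp
    then show "d ((\<lambda>x\<in>M. inv_into M g x) x) ((\<lambda>x\<in>M. inv_into M g x) y) = d x y"
      using xy bij by (simp add: bij_betw_inv_into_right)
  qed auto
next
  fix g h assume gh: "g \<in> carrier isom_group" "h \<in> carrier isom_group"
  then have "g \<otimes>\<^bsub>BijGroup M\<^esub> h = compose M g h"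
    by (simp add: BijGroup_def isom_groupD)
  moreover have "compose M g h \<in> carrier isom_group"
    using isom_groupD[OF gh(1)] isom_groupD[OF gh(2)]
    by (intro isom_groupI) (auto simp: compose_def image_iff, metis image_iff)
  ultimately show "g \<otimes>\<^bsub>BijGroup M\<^esub> h \<in> carrier isom_group"
    by simp
qed

lemma group_isom_group: "group isom_group"
  using subgroup.subgroup_is_group[OF subgroup_isom_group group_BijGroup]
  by (simp add: isom_group_def)

lemma isom_group_one [simp]: "x \<in> M \<Longrightarrow> \<one>\<^bsub>isom_group\<^esub> x = x"
  by (simp add: isom_group_def BijGroup_def)

lemma isom_group_mult [simp]:
  assumes "g \<in> carrier isom_group" "h \<in> carrier isom_group" "x \<in> M"
  shows "(g \<otimes>\<^bsub>isom_group\<^esub> h) x = g (h x)"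
  using assms by (simp add: isom_group_def BijGroup_def compose_eq)

lemma isom_group_inv [simp]:
  assumes "g \<in> carrier isom_group" "x \<in> M"
  shows "g ((inv\<^bsub>isom_group\<^esub> g) x) = x" "(inv\<^bsub>isom_group\<^esub> g) (g x) = x"
proof -
  interpret group isom_group by (rule group_isom_group)
  show "g ((inv\<^bsub>isom_group\<^esub> g) x) = x" "(inv\<^bsub>isom_group\<^esub> g) (g x) = x"
    using assms isom_group_mult[of g "inv\<^bsub>isom_group\<^esub> g" x]
      isom_group_mult[of "inv\<^bsub>isom_group\<^esub> g" g x] by simp_all
qed

section \<open>Pointwise convergence as a Hausdorff group topology\<close>

lemma topspace_pointwise_topology [simp]: "topspace pointwise_topology = carrier isom_group"
  using isom_groupD by (fastforce simp: pointwise_topology_def PiE_iff)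

lemma continuous_map_pointwise_topology:
  "continuous_map X pointwise_topology f \<longleftrightarrow>
     f \<in> topspace X \<rightarrow> carrier isom_group \<and> (\<forall>x\<in>M. continuous_map X mtopology (\<lambda>g. f g x))"
  using isom_groupD(2)
  by (fastforce simp: pointwise_topology_def continuous_map_in_subtopology
      continuous_map_componentwise)

lemma limitin_pointwise_topology:
  "limitin pointwise_topology f g F \<longleftrightarrow>
     g \<in> carrier isom_group \<and> (\<forall>\<^sub>F k in F. f k \<in> carrier isom_group) \<and>
     (\<forall>x\<in>M. limitin mtopology (\<lambda>k. f k x) (g x) F)"
proof -
  have "carrier isom_group \<subseteq> topspace (product_topology (\<lambda>_. mtopology) M)"
    using isom_groupD by (fastforce simp: PiE_iff)
  then show ?thesis
    using isom_groupD(2) unfolding pointwise_topology_def limitin_subtopology limitin_componentwise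
    by (auto simp: subset_iff elim!: eventually_mono)
qed

lemma openin_pointwise_mball:
  assumes "x \<in> M"
  shows "openin pointwise_topology {g \<in> carrier isom_group. g x \<in> mball y r}"
proof -
  have "continuous_map pointwise_topology mtopology (\<lambda>g. g x)"
    using continuous_map_pointwise_topology[of pointwise_topology id] assms by simp
  then show ?thesis
    using openin_continuous_map_preimage openin_mball by fastforce
qed

lemma Hausdorff_pointwise_topology: "Hausdorff_space pointwise_topology"
  unfolding pointwise_topology_def
  by (intro Hausdorff_space_subtopology)
     (simp add: Hausdorff_space_product_topology Hausdorff_space_mtopology)

text \<open>Isometries are equicontinuous. For products, the distance from \<open>g (h x)\<close> to
  \<open>g' (h' x)\<close> is at most the error of \<open>g'\<close> at \<open>h x\<close> plus the
  error of \<open>h'\<close> at \<open>x\<close>. For inverses, with \<open>g y = x\<close>, the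
  error of the inverse of \<open>g'\<close> at \<open>x\<close> equals the error of
  \<open>g'\<close> at \<open>y\<close>.\<close>

lemma group_topology_pointwise: "group_topology isom_group pointwise_topology"
  unfolding group_topology_def
proof (intro conjI)
  interpret group isom_group by (rule group_isom_group)
  show "group isom_group" "topspace pointwise_topology = carrier isom_group"
    by (simp_all add: group_isom_group)
  show "continuous_map (prod_topology pointwise_topology pointwise_topology) pointwise_topology
          (\<lambda>(g, h). g \<otimes>\<^bsub>isom_group\<^esub> h)"
    unfolding continuous_map_pointwise_topology continuous_map_to_metric
  proof (intro conjI ballI allI impI)
    fix x p \<epsilon>
    assume x: "x \<in> M" and p: "p \<in> topspace (prod_topology pointwise_topology pointwise_topology)"
      and \<epsilon>: "0 < (\<epsilon>::real)"
    obtain g h where gh: "p = (g, h)" "g \<in> carrier isom_group" "h \<in> carrier isom_group"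
      using p by auto
    define U where "U = {g' \<in> carrier isom_group. g' (h x) \<in> mball (g (h x)) (\<epsilon>/2)}"
    define V where "V = {h' \<in> carrier isom_group. h' x \<in> mball (h x) (\<epsilon>/2)}"
    have "openin (prod_topology pointwise_topology pointwise_topology) (U \<times> V)"
      unfolding U_def V_def openin_prod_Times_iff
      using openin_pointwise_mball isom_groupD(4)[OF gh(3)] x by blast
    moreover have "p \<in> U \<times> V"
      using gh x \<epsilon> isom_groupD(4) by (simp add: U_def V_def)
    moreover have "(case q of (g, h) \<Rightarrow> g \<otimes>\<^bsub>isom_group\<^esub> h) x
        \<in> mball ((case p of (g, h) \<Rightarrow> g \<otimes>\<^bsub>isom_group\<^esub> h) x) \<epsilon>"
      if q: "q \<in> U \<times> V" for q
    proof -
      obtain g' h' where q: "q = (g', h')" "g' \<in> U" "h' \<in> V"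
        using q by auto
      have c: "g' \<in> carrier isom_group" "h' \<in> carrier isom_group"
        using q by (auto simp: U_def V_def)
      have m: "h x \<in> M" "h' x \<in> M" "g (h x) \<in> M" "g' (h x) \<in> M" "g' (h' x) \<in> M"
        using c gh x by (auto simp: isom_groupD)
      have "d (g (h x)) (g' (h' x)) \<le> d (g (h x)) (g' (h x)) + d (g' (h x)) (g' (h' x))"
        using triangle m by blast
      also have "\<dots> < \<epsilon>"
        using q isom_groupD(5)[OF c(1) m(1,2)] by (auto simp: U_def V_def)
      finally show ?thesis
        using q gh c x m by simp
    qed
    ultimately show "\<exists>U. openin (prod_topology pointwise_topology pointwise_topology) U \<and> p \<in> U \<and>
        (\<forall>q\<in>U. (case q of (g, h) \<Rightarrow> g \<otimes>\<^bsub>isom_group\<^esub> h) x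
           \<in> mball ((case p of (g, h) \<Rightarrow> g \<otimes>\<^bsub>isom_group\<^esub> h) x) \<epsilon>)"
      by blast
  qed auto
  show "continuous_map pointwise_topology pointwise_topology (\<lambda>g. inv\<^bsub>isom_group\<^esub> g)"
    unfolding continuous_map_pointwise_topology continuous_map_to_metric
  proof (intro conjI ballI allI impI)
    fix x g \<epsilon>
    assume x: "x \<in> M" and g: "g \<in> topspace pointwise_topology" and \<epsilon>: "0 < (\<epsilon>::real)"
    define y where "y = (inv\<^bsub>isom_group\<^esub> g) x"
    have y: "y \<in> M" "g y = x"
      using g x isom_groupD(4) by (simp_all add: y_def)
    define U where "U = {g' \<in> carrier isom_group. g' y \<in> mball (g y) \<epsilon>}"
    have "(inv\<^bsub>isom_group\<^esub> g') x \<in> mball ((inv\<^bsub>isom_group\<^esub> g) x) \<epsilon>" if "g' \<in> U" for g'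
    proof -
      have g': "g' \<in> carrier isom_group" and lt: "d x (g' y) < \<epsilon>"
        using that y by (auto simp: U_def)
      have m: "(inv\<^bsub>isom_group\<^esub> g') x \<in> M"
        using g' x isom_groupD(4) by simp
      have "d y ((inv\<^bsub>isom_group\<^esub> g') x) = d (g' y) (g' ((inv\<^bsub>isom_group\<^esub> g') x))"
        using isom_groupD(5)[OF g' y(1) m] by simp
      also have "\<dots> < \<epsilon>"
        using g' x lt by (simp add: commute)
      finally show ?thesis
        using m y by (simp add: y_def)
    qed
    moreover have "openin pointwise_topology U"
      unfolding U_def using y(1) by (rule openin_pointwise_mball)
    moreover have "g \<in> U"
      using y g x \<epsilon> by (auto simp: U_def)
    ultimately show "\<exists>U. openin pointwise_topology U \<and> g \<in> U \<and>
        (\<forall>g'\<in>U. (inv\<^bsub>isom_group\<^esub> g') x \<in> mball ((inv\<^bsub>isom_group\<^esub> g) x) \<epsilon>)"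
      by blast
  qed auto
qed

end

section \<open>The hyperbolic space\<close>

locale hyperbolic_hilbert =
  fixes e :: "nat \<Rightarrow> 'a::{real_inner, banach}"
  assumes basis: "hilbert_basis e"
begin

section \<open>Orthonormal expansions\<close>

lemma inner_basis [simp]: "e i \<bullet> e j = (if i = j then 1 else 0)"
  using basis by (simp add: hilbert_basis_def)

text \<open>Orthogonal projection onto the span of the first \<open>n\<close> basis vectors;
  \<open>x - head n x\<close> is the tail of \<open>x\<close>.\<close>

definition head :: "nat \<Rightarrow> 'a \<Rightarrow> 'a" where
  "head n x = (\<Sum>i<n. (x \<bullet> e i) *\<^sub>R e i)"

lemma head_inner_basis [simp]: "head n x \<bullet> e i = (if i < n then x \<bullet> e i else 0)"
  by (simp add: head_def inner_sum_left if_distrib cong: if_cong)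

lemma head_inner: "head n x \<bullet> y = (\<Sum>i<n. (x \<bullet> e i) * (y \<bullet> e i))"
  by (simp only: head_def inner_sum_left inner_scaleR_left inner_commute[of y])

lemma head_inner_head: "head n x \<bullet> head n y = head n x \<bullet> y"
  unfolding head_inner[of n x] by simp

lemma norm_diff_head: "(norm (x - head n x))\<^sup>2 = (norm x)\<^sup>2 - (\<Sum>i<n. (x \<bullet> e i)\<^sup>2)"
  using head_inner_head[of n x x]
  by (simp add: power2_norm_eq_inner inner_diff inner_commute[of x "head n x"])
     (simp add: head_inner power2_eq_square)

lemma norm_diff_head_le: "norm (x - head n x) \<le> norm x"
  by (rule power2_le_imp_le) (simp_all add: norm_diff_head sum_nonneg)

text \<open>\<open>head n\<close> eventually fixes a finite combination \<open>y\<close> close to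
  \<open>x\<close>, and passing to tails does not increase norms, so the error at \<open>x\<close>
  is then at most \<open>norm (x - y)\<close>.\<close>

lemma head_tendsto: "(\<lambda>n. head n x) \<longlonglongrightarrow> x"
proof (rule LIMSEQ_I)
  fix r :: real assume r: "r > 0"
  have "x \<in> closure (span (range e))"
    using basis by (simp add: hilbert_basis_def)
  then obtain y where y: "y \<in> span (range e)" "dist y x < r"
    using r closure_approachable by blast
  have head_diff: "head n (a - c *\<^sub>R b) = head n a - c *\<^sub>R head n b" for n a b c
    by (simp add: head_def inner_diff_left scaleR_diff_left sum_subtractf scaleR_sum_right)
  have "\<exists>N. \<forall>n\<ge>N. head n y = y"
    using y(1)
  proof (induction rule: span_induct_alt)
    case base
    show ?case
      by (simp add: head_def)
  next
    case (step c b y)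
    then obtain N k where N: "\<forall>n\<ge>N. head n y = y" and k: "b = e k"
      by auto
    have "head n b = b" if "n > k" for n
      using that by (simp add: head_def k if_distrib[of "\<lambda>c. c *\<^sub>R _"] cong: if_cong)
    then have "\<forall>n\<ge>max N (Suc k). head n (c *\<^sub>R b + y) = c *\<^sub>R b + y"
      using N head_diff[of _ y "- c" b] by (simp add: add.commute)
    then show ?case
      by blast
  qed
  then obtain N where N: "\<forall>n\<ge>N. head n y = y"
    by blast
  have "norm (head n x - x) < r" if "n \<ge> N" for n
  proof -
    have "norm (head n x - x) = norm ((x - y) - head n (x - y))"
      using N that head_diff[of n x 1 y] by (simp add: norm_minus_commute)
    also have "\<dots> \<le> norm (x - y)"
      by (rule norm_diff_head_le)
    finally show ?thesis
      using y(2) by (simp add: dist_norm norm_minus_commute)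
  qed
  then show "\<exists>N. \<forall>n\<ge>N. norm (head n x - x) < r"
    by blast
qed

lemma parseval: "(\<lambda>i. (x \<bullet> e i)\<^sup>2) sums (norm x)\<^sup>2"
proof -
  have "(\<lambda>n. head n x \<bullet> x) \<longlonglongrightarrow> x \<bullet> x"
    by (intro tendsto_intros head_tendsto)
  then show ?thesis
    by (simp add: sums_def head_inner power2_eq_square dot_square_norm)
qed

text \<open>The polarized form without a series: by Parseval, the inner product is the sum over all
  coordinates, so this expression keeps the zeroth product with sign plus and all others with sign
  minus.\<close>

definition B :: "'a \<Rightarrow> 'a \<Rightarrow> real" where
  "B x y = 2 * (x \<bullet> e 0) * (y \<bullet> e 0) - x \<bullet> y"

lemma hyp_Q_eq: "hyp_Q e x = B x x"
  using suminf_split_head[OF sums_summable[OF parseval[of x]]]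
    sums_unique[OF parseval[of x], symmetric]
  by (simp add: hyp_Q_def B_def power2_norm_eq_inner) (simp add: power2_eq_square)

lemma B_commute: "B x y = B y x"
  by (simp add: B_def inner_commute)

lemma B_linear [simp]:
  "B (x + x') y = B x y + B x' y" "B y (x + x') = B y x + B y x'"
  "B (x - x') y = B x y - B x' y" "B y (x - x') = B y x - B y x'"
  "B (c *\<^sub>R x) y = c * B x y" "B y (c *\<^sub>R x) = c * B y x"
  "B (- x) y = - B x y" "B y (- x) = - B y x" "B 0 y = 0" "B y 0 = 0"
  by (simp_all add: B_def inner_left_distrib inner_right_distrib inner_diff algebra_simps)

lemma hyp_form_eq: "hyp_form e x y = B x y"
  by (simp add: hyp_form_def hyp_Q_eq B_commute[of y x])

abbreviation H :: "'a set" where "H \<equiv> hyp_space e"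

lemma H_iff: "x \<in> H \<longleftrightarrow> B x x = 1 \<and> x \<bullet> e 0 > 0"
  by (simp add: hyp_space_def hyp_Q_eq)

lemma basis0_in_H [simp]: "e 0 \<in> H"
  by (simp add: H_iff B_def)

lemma B_basis0: "B x (e 0) = x \<bullet> e 0" "B (e 0) x = x \<bullet> e 0"
  by (simp_all add: B_def inner_commute)

text \<open>The form has a single positive direction, so it is negative definite on the orthogonal
  complement of \<open>y\<close>. The reason is Cauchy-Schwarz for the parts of \<open>a\<close> and
  \<open>y\<close> orthogonal to \<open>e 0\<close>, whose inner product is
  \<open>a0 * y0\<close>.\<close>

lemma B_nonpos:
  assumes "B a y = 0" "B y y = 1"
  shows "B a a \<le> 0" and "B a a = 0 \<Longrightarrow> a = 0"
proof -
  define a0 y0 A where "a0 = a \<bullet> e 0" "y0 = y \<bullet> e 0" "A = a \<bullet> a - a0\<^sup>2"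
  have "((a - a0 *\<^sub>R e 0) \<bullet> (y - y0 *\<^sub>R e 0))\<^sup>2
      \<le> ((a - a0 *\<^sub>R e 0) \<bullet> (a - a0 *\<^sub>R e 0)) * ((y - y0 *\<^sub>R e 0) \<bullet> (y - y0 *\<^sub>R e 0))"
    by (rule Cauchy_Schwarz_ineq)
  moreover have "(a - a0 *\<^sub>R e 0) \<bullet> (y - y0 *\<^sub>R e 0) = a0 * y0"
    "(a - a0 *\<^sub>R e 0) \<bullet> (a - a0 *\<^sub>R e 0) = A"
    "(y - y0 *\<^sub>R e 0) \<bullet> (y - y0 *\<^sub>R e 0) = y0\<^sup>2 - 1"
    using assms by (simp_all add: B_def a0_y0_A_def inner_diff inner_commute power2_eq_square
        algebra_simps)
  ultimately have *: "a0\<^sup>2 * y0\<^sup>2 \<le> A * (y0\<^sup>2 - 1)" "A \<ge> 0"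
    using inner_ge_zero[of "a - a0 *\<^sub>R e 0"] by (simp_all add: power_mult_distrib)
  have y0: "y0\<^sup>2 \<ge> 1"
    using inner_ge_zero[of "y - y0 *\<^sub>R e 0"]
      \<open>(y - y0 *\<^sub>R e 0) \<bullet> (y - y0 *\<^sub>R e 0) = y0\<^sup>2 - 1\<close> by simp
  have eq: "B a a = a0\<^sup>2 - A"
    by (simp add: B_def a0_y0_A_def power2_eq_square)
  have le: "y0\<^sup>2 * B a a \<le> - A"
    using *(1) by (simp add: eq algebra_simps)
  then show "B a a \<le> 0"
    using *(2) y0 by (smt (verit) mult_pos_pos)
  assume "B a a = 0"
  then have "A = 0" "a0\<^sup>2 = 0"
    using le *(2) eq by auto
  then show "a = 0"
    by (simp add: a0_y0_A_def)
qed

text \<open>By \<open>B_nonpos\<close>, \<open>- B\<close> is an inner product on the complement of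
  \<open>y\<close>, so the classical argument applies.\<close>

lemma B_Cauchy_Schwarz:
  assumes "B a y = 0" "B c y = 0" "B y y = 1"
  shows "(B a c)\<^sup>2 \<le> B a a * B c c"
proof (cases "c = 0")
  case False
  then have neg: "B c c < 0"
    using B_nonpos[of c y] assms by force
  \<comment> \<open>The maximum point of the concave quadratic
    \<open>B (a + t *\<^sub>R c) (a + t *\<^sub>R c)\<close> in \<open>t\<close>.\<close>
  define t where "t = - B a c / B c c"
  have "B (a + t *\<^sub>R c) (a + t *\<^sub>R c) \<le> 0"
    using assms by (intro B_nonpos(1)[of _ y]) auto
  moreover have "B (a + t *\<^sub>R c) (a + t *\<^sub>R c) = B a a + 2 * t * B a c + t\<^sup>2 * B c c"
    by (simp add: B_commute[of c a] algebra_simps power2_eq_square)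
  moreover have "\<dots> = B a a - (B a c)\<^sup>2 / B c c"
    using neg by (simp add: t_def field_simps power2_eq_square)
  ultimately have "B a a \<le> (B a c)\<^sup>2 / B c c"
    by simp
  then show ?thesis
    using neg by (simp add: field_simps)
qed simp

text \<open>A strict Cauchy-Schwarz estimate away from \<open>e 0\<close> shows that
  \<open>B x y\<close> is positive, since both zeroth coordinates are. The complement of
  \<open>y\<close> being negative then gives the bound on the square.\<close>

lemma B_ge_1:
  assumes "x \<in> H" "y \<in> H"
  shows "B x y \<ge> 1"
proof -
  define x0 y0 where "x0 = x \<bullet> e 0" "y0 = y \<bullet> e 0"
  have "(x \<bullet> y - x0 * y0)\<^sup>2 \<le> (x \<bullet> x - x0\<^sup>2) * (y \<bullet> y - y0\<^sup>2)"
    using Cauchy_Schwarz_ineq[of "x - x0 *\<^sub>R e 0" "y - y0 *\<^sub>R e 0"]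
    by (simp add: x0_y0_def inner_diff inner_commute power2_eq_square algebra_simps)
  also have "x \<bullet> x = 2 * x0\<^sup>2 - 1"
    using assms by (simp add: H_iff B_def x0_y0_def power2_eq_square)
  also have "y \<bullet> y = 2 * y0\<^sup>2 - 1"
    using assms by (simp add: H_iff B_def x0_y0_def power2_eq_square)
  also have "(2 * x0\<^sup>2 - 1 - x0\<^sup>2) * (2 * y0\<^sup>2 - 1 - y0\<^sup>2) = (x0\<^sup>2 - 1) * (y0\<^sup>2 - 1)"
    by simp
  also have "\<dots> < (x0 * y0)\<^sup>2"
  proof -
    have "x0\<^sup>2 > 0" "y0\<^sup>2 \<ge> 1"
      using assms Cauchy_Schwarz_ineq[of y "e 0"]
      by (auto simp: H_iff B_def x0_y0_def power2_eq_square)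
    moreover have "(x0\<^sup>2 - 1) * (y0\<^sup>2 - 1) = (x0 * y0)\<^sup>2 - (x0\<^sup>2 + y0\<^sup>2 - 1)"
      by (simp add: algebra_simps power_mult_distrib)
    ultimately show ?thesis
      by linarith
  qed
  finally have "\<bar>x \<bullet> y - x0 * y0\<bar> < \<bar>x0 * y0\<bar>"
    using power2_less_imp_less power2_abs by (metis abs_ge_zero)
  then have pos: "B x y > 0"
    using assms by (auto simp: B_def x0_y0_def H_iff abs_mult)
  \<comment> \<open>This is the component of \<open>x\<close> orthogonal to \<open>y\<close>; its
    value under \<open>B\<close> is \<open>1 - (B x y)\<^sup>2\<close>.\<close>
  have "B (x - B x y *\<^sub>R y) (x - B x y *\<^sub>R y) \<le> 0"
    using assms by (intro B_nonpos(1)[of _ y]) (auto simp: H_iff)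
  then have "1 \<le> (B x y)\<^sup>2"
    using assms by (simp add: H_iff B_commute[of y x] power2_eq_square)
  then show ?thesis
    using pos by (smt (verit) one_le_power power2_le_imp_le one_power2)
qed

text \<open>The difference \<open>x - y\<close> is then orthogonal to \<open>y\<close> and
  isotropic, hence zero by definiteness.\<close>

lemma B_eq_1_imp_eq:
  assumes "x \<in> H" "y \<in> H" "B x y = 1"
  shows "x = y"
  using B_nonpos(2)[of "x - y" y] assms by (simp add: H_iff B_commute[of y x])

section \<open>The hyperbolic metric\<close>

abbreviation dH :: "'a \<Rightarrow> 'a \<Rightarrow> real" where "dH \<equiv> hyp_dist e"

lemma dH_eq: "x \<in> H \<Longrightarrow> y \<in> H \<Longrightarrow> dH x y = arcosh (B x y)"
  by (simp add: hyp_dist_def hyp_form_eq)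

lemma cosh_dH: "x \<in> H \<Longrightarrow> y \<in> H \<Longrightarrow> cosh (dH x y) = B x y"
  by (simp add: dH_eq B_ge_1)

lemma dH_nonneg: "dH x y \<ge> 0"
  by (simp add: hyp_dist_def hyp_form_eq B_ge_1)

lemma dH_less_iff: "x \<in> H \<Longrightarrow> y \<in> H \<Longrightarrow> \<epsilon> > 0 \<Longrightarrow> dH x y < \<epsilon> \<longleftrightarrow> B x y < cosh \<epsilon>"
  by (metis cosh_dH cosh_real_nonneg_less_iff dH_nonneg less_imp_le)

text \<open>For the triangle inequality, \<open>x\<close> and \<open>z\<close> are split along
  \<open>y\<close>. Then \<open>B x z\<close> is the product of the two cosh values plus
  \<open>B a c\<close>, and \<open>B_Cauchy_Schwarz\<close> bounds \<open>B a c\<close> by the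
  product of the sinh values; the addition formula for cosh concludes.\<close>

lemma Metric_space_H: "Metric_space H dH"
proof
  show "0 \<le> dH x y" for x y
    by (rule dH_nonneg)
  show "dH x y = dH y x" for x y
    by (simp add: hyp_dist_def hyp_form_eq B_commute)
  show "dH x y = 0 \<longleftrightarrow> x = y" if "x \<in> H" "y \<in> H" for x y
    using that B_eq_1_imp_eq[OF that] B_ge_1[OF that]
    by (auto simp: dH_eq H_iff)
  show "dH x z \<le> dH x y + dH y z" if "x \<in> H" "y \<in> H" "z \<in> H" for x y z
  proof -
    define a c where "a = x - B x y *\<^sub>R y" "c = z - B y z *\<^sub>R y"
    have orth: "B a y = 0" "B c y = 0"
      using that by (simp_all add: a_c_def H_iff B_commute[of z y])
    have aa: "B a a = 1 - (B x y)\<^sup>2" and cc: "B c c = 1 - (B y z)\<^sup>2"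
      and ac: "B a c = B x z - B x y * B y z"
      using that by (simp_all add: a_c_def H_iff B_commute[of y x] B_commute[of z y]
          power2_eq_square algebra_simps)
    have "(B a c)\<^sup>2 \<le> ((B x y)\<^sup>2 - 1) * ((B y z)\<^sup>2 - 1)"
      using B_Cauchy_Schwarz[OF orth] that unfolding aa cc by (simp add: H_iff algebra_simps)
    then have "B a c \<le> sqrt ((B x y)\<^sup>2 - 1) * sqrt ((B y z)\<^sup>2 - 1)"
      by (simp add: real_le_rsqrt flip: real_sqrt_mult)
    then have "cosh (dH x z) \<le> cosh (dH x y + dH y z)"
      using that by (simp add: ac cosh_add cosh_dH dH_eq sinh_arcosh_real B_ge_1)
    then show ?thesis
      using dH_nonneg by (simp add: cosh_real_nonneg_le_iff)
  qed
qed

sublocale M: Metric_space H dH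
  by (rule Metric_space_H)

abbreviation "G \<equiv> M.isom_group"
abbreviation "T \<equiv> M.pointwise_topology"

lemma hyp_Isom_eq: "hyp_Isom e = G"
  by (simp add: hyp_Isom_def M.isom_group_def)

lemma hyp_pointwise_topology_eq: "hyp_pointwise_topology e = T"
  by (simp add: hyp_pointwise_topology_def M.pointwise_topology_def hyp_Isom_eq)

sublocale G: group G
  by (rule M.group_isom_group)

lemmas isom_in_H = M.isom_groupD(4)

lemma isom_B:
  assumes "g \<in> carrier G" "x \<in> H" "y \<in> H"
  shows "B (g x) (g y) = B x y"
  using M.isom_groupD(5)[OF assms] assms isom_in_H by (metis cosh_dH)

lemma isomI:
  assumes "g \<in> extensional H" "g ` H = H" "\<And>x y. x \<in> H \<Longrightarrow> y \<in> H \<Longrightarrow> B (g x) (g y) = B x y"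
  shows "g \<in> carrier G"
proof (rule M.isom_groupI)
  show "dH (g x) (g y) = dH x y" if "x \<in> H" "y \<in> H" for x y
  proof -
    have "g x \<in> H" "g y \<in> H"
      using that assms(2) by auto
    then show ?thesis
      using that assms(3) by (simp add: dH_eq)
  qed
qed (use assms in auto)

subsection \<open>Isometries and reflections\<close>

text \<open>The quadric has two sheets. A point \<open>y\<close> of the other one has
  \<open>- y\<close> in \<open>H\<close>, which makes \<open>B x y\<close> at most -1.\<close>

lemma in_H_of_B_pos:
  assumes "B y y = 1" "x \<in> H" "B x y > 0"
  shows "y \<in> H"
proof (rule ccontr)
  assume "y \<notin> H"
  then have "y \<bullet> e 0 \<le> 0"
    using assms by (simp add: H_iff)
  moreover have "y \<bullet> e 0 \<noteq> 0"
    using assms(1) inner_ge_zero[of y] by (auto simp: B_def simp del: inner_ge_zero)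
  ultimately have "- y \<in> H"
    using assms(1) by (simp add: H_iff)
  then show False
    using B_ge_1[OF assms(2)] assms(3) by fastforce
qed

text \<open>Adding a large multiple of \<open>e 0\<close> to any vector makes it positive for
  \<open>B\<close> with positive zeroth coordinate, and rescaling then puts it in
  \<open>H\<close>.\<close>

lemma in_span_H:
  obtains p a c where "p \<in> H" "z = a *\<^sub>R p - c *\<^sub>R e 0"
proof
  \<comment> \<open>Large enough that \<open>c\<^sup>2 - 2 * c * n - n\<^sup>2\<close>, a lower
    bound for \<open>B y y\<close>, is positive.\<close>
  define n c where "n = norm z" "c = 3 * (n + 1)"
  define y where "y = z + c *\<^sub>R e 0"
  have n: "n \<ge> 0" "\<bar>z \<bullet> e 0\<bar> \<le> n"
    using Cauchy_Schwarz_ineq2[of z "e 0"] by (simp_all add: n_c_def norm_eq_sqrt_inner)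
  have "B z z \<ge> - n\<^sup>2"
    by (simp add: B_def n_c_def power2_norm_eq_inner)
  moreover have "B y y = B z z + 2 * c * (z \<bullet> e 0) + c\<^sup>2"
    by (simp add: y_def B_basis0 B_commute[of "e 0"] power2_eq_square algebra_simps)
  moreover have "c * (z \<bullet> e 0) \<ge> c * - n"
    using n by (intro mult_left_mono) (auto simp: n_c_def)
  ultimately have "B y y \<ge> c\<^sup>2 - 2 * c * n - n\<^sup>2"
    by simp
  also have "c\<^sup>2 - 2 * c * n - n\<^sup>2 = 2 * n\<^sup>2 + 12 * n + 9"
    by (simp add: n_c_def power2_eq_square algebra_simps)
  finally have pos: "B y y > 0"
    using n by (smt (verit) zero_le_power2)
  have "y \<bullet> e 0 > 0"
    using n by (simp add: y_def n_c_def inner_left_distrib)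
  then show "(1 / sqrt (B y y)) *\<^sub>R y \<in> H"
    using pos by (simp add: H_iff field_simps)
  show "z = sqrt (B y y) *\<^sub>R ((1 / sqrt (B y y)) *\<^sub>R y) - c *\<^sub>R e 0"
    using pos by (simp add: y_def)
qed

lemma B_nondegenerate:
  assumes "\<And>w. w \<in> H \<Longrightarrow> B a w = 0"
  shows "a = 0"
proof -
  \<comment> \<open>Negating all coordinates of \<open>a\<close> but the zeroth turns
    \<open>B a z\<close> into \<open>a \<bullet> a\<close>.\<close>
  define z where "z = (2 * (a \<bullet> e 0)) *\<^sub>R e 0 - a"
  obtain p r c where "p \<in> H" "z = r *\<^sub>R p - c *\<^sub>R e 0"
    by (rule in_span_H)
  then have "B a z = 0"
    using assms by simp
  then have "a \<bullet> a = 0"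
    by (simp add: z_def) (simp add: B_def)
  then show ?thesis
    by simp
qed

text \<open>The value at \<open>z\<close> of the linear extension of an isometry.\<close>

lemma isom_extension:
  assumes g: "g \<in> carrier G"
  obtains v where "B v v = B z z" "\<And>x. x \<in> H \<Longrightarrow> B v (g x) = B z x"
proof -
  obtain p r c where p: "p \<in> H" and z: "z = r *\<^sub>R p - c *\<^sub>R e 0"
    by (rule in_span_H)
  define v where "v = r *\<^sub>R g p - c *\<^sub>R g (e 0)"
  show ?thesis
  proof
    show "B v v = B z z"
      using p g by (simp add: v_def z isom_B)
    show "B v (g x) = B z x" if "x \<in> H" for x
      using p g that by (simp add: v_def z isom_B)
  qed
qed

text \<open>The reflection in the hyperplane orthogonal to \<open>v\<close>. The usual formula
  subtracts twice \<open>B x v / B v v\<close> times \<open>v\<close>; the plus sign reflects the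
  normalisation \<open>B v v = -1\<close>.\<close>

definition mirror :: "'a \<Rightarrow> 'a \<Rightarrow> 'a" where
  "mirror v = (\<lambda>x\<in>H. x + (2 * B x v) *\<^sub>R v)"

lemma mirror_apply: "x \<in> H \<Longrightarrow> mirror v x = x + (2 * B x v) *\<^sub>R v"
  by (simp add: mirror_def)

text \<open>The image stays on the same sheet because its product with \<open>x\<close> is
  \<open>1 + 2 * (B x v)\<^sup>2\<close>.\<close>

lemma mirror_in_H:
  assumes "B v v = -1" "x \<in> H"
  shows "mirror v x \<in> H"
proof (rule in_H_of_B_pos)
  show "B (mirror v x) (mirror v x) = 1"
    using assms by (simp add: mirror_apply H_iff B_commute[of v x])
  show "B x (mirror v x) > 0"
    using assms by (simp add: mirror_apply H_iff add_pos_nonneg)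
qed fact

lemma mirror_mirror:
  assumes "B v v = -1" "x \<in> H"
  shows "mirror v (mirror v x) = x"
  using assms mirror_in_H[OF assms] by (simp add: mirror_apply)

lemma mirror_in_G:
  assumes "B v v = -1"
  shows "mirror v \<in> carrier G"
proof (rule isomI)
  show "mirror v \<in> extensional H"
    by (simp add: mirror_def)
  show "mirror v ` H = H"
    using mirror_in_H[OF assms] mirror_mirror[OF assms] by (auto simp: image_iff) metis
  show "B (mirror v x) (mirror v y) = B x y" if "x \<in> H" "y \<in> H" for x y
    using that assms by (simp add: mirror_apply B_commute[of v y] algebra_simps)
qed

lemma mirror_mult_mirror:
  assumes "B v v = -1"
  shows "mirror v \<otimes>\<^bsub>G\<^esub> mirror v = \<one>\<^bsub>G\<^esub>"
  using assms by (intro M.isom_group_eqI) (auto simp: mirror_in_G mirror_mirror)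

lemma mirror_neq_one:
  assumes "B v v = -1"
  shows "mirror v \<noteq> \<one>\<^bsub>G\<^esub>"
proof
  assume eq: "mirror v = \<one>\<^bsub>G\<^esub>"
  have "v \<noteq> 0"
    using assms by auto
  have "B v x = 0" if "x \<in> H" for x
    using mirror_apply[OF that, of v] that \<open>v \<noteq> 0\<close> by (simp add: eq B_commute)
  then show False
    using B_nondegenerate \<open>v \<noteq> 0\<close> by blast
qed

text \<open>Here \<open>v\<close> is the value at \<open>z\<close> of the linear extension of the
  inverse of \<open>g\<close>; \<open>z\<close> lies outside \<open>H\<close>, so the inverse cannot
  be applied to it directly. At \<open>x = e 0\<close> the second property reads off the zeroth
  coordinate of \<open>v\<close>.\<close>

lemma mirror_conjugate:
  assumes g: "g \<in> carrier G" and z: "B z z = -1"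
  obtains v where "B v v = -1" "\<And>x. x \<in> H \<Longrightarrow> B v x = B z (g x)"
    "inv\<^bsub>G\<^esub> g \<otimes>\<^bsub>G\<^esub> mirror z \<otimes>\<^bsub>G\<^esub> g = mirror v"
proof -
  have ig: "inv\<^bsub>G\<^esub> g \<in> carrier G"
    using g by simp
  obtain v where v: "B v v = B z z" "\<And>x. x \<in> H \<Longrightarrow> B v ((inv\<^bsub>G\<^esub> g) x) = B z x"
    using isom_extension[OF ig] by blast
  have Bv: "B v x = B z (g x)" if "x \<in> H" for x
    using v(2)[of "g x"] g that isom_in_H by simp
  have "inv\<^bsub>G\<^esub> g \<otimes>\<^bsub>G\<^esub> mirror z \<otimes>\<^bsub>G\<^esub> g = mirror v"
  proof (rule M.isom_group_eqI)
    show "inv\<^bsub>G\<^esub> g \<otimes>\<^bsub>G\<^esub> mirror z \<otimes>\<^bsub>G\<^esub> g \<in> carrier G" "mirror v \<in> carrier G"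
      using g z v by (simp_all add: mirror_in_G)
    fix x assume x: "x \<in> H"
    then have gx: "g x \<in> H" and rgx: "mirror z (g x) \<in> H"
      using g z isom_in_H mirror_in_H by auto
    \<comment> \<open>Elements of \<open>carrier G\<close> are not given as linear maps, so the two
      points are compared by pairing them with all of \<open>H\<close>.\<close>
    have "(inv\<^bsub>G\<^esub> g) (mirror z (g x)) - mirror v x = 0"
    proof (rule B_nondegenerate)
      fix w assume w: "w \<in> H"
      have "B ((inv\<^bsub>G\<^esub> g) (mirror z (g x))) w
          = B (g ((inv\<^bsub>G\<^esub> g) (mirror z (g x)))) (g w)"
        using isom_B[OF g isom_in_H[OF ig rgx] w] by simp
      also have "\<dots> = B (mirror z (g x)) (g w)"
        using g rgx by simp
      also have "\<dots> = B x w + 2 * B v x * B v w"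
        using gx x w g by (simp add: mirror_apply isom_B Bv B_commute[of "g x" z])
      also have "\<dots> = B (mirror v x) w"
        using x by (simp add: mirror_apply B_commute[of x v])
      finally show "B ((inv\<^bsub>G\<^esub> g) (mirror z (g x)) - mirror v x) w = 0"
        by simp
    qed
    then show "(inv\<^bsub>G\<^esub> g \<otimes>\<^bsub>G\<^esub> mirror z \<otimes>\<^bsub>G\<^esub> g) x = mirror v x"
      using g z x gx by (simp add: mirror_in_G)
  qed
  then show thesis
    using that[of v] v z Bv by simp
qed

text \<open>Two mirrors at angle \<open>\<pi>/3\<close> generate a dihedral group of order 6.\<close>

lemma mirror_braid:
  assumes v: "B v v = -1" and a: "B a a = -1" and va: "B v a = 1/2"
  shows "mirror v \<otimes>\<^bsub>G\<^esub> mirror a \<otimes>\<^bsub>G\<^esub> mirror v \<otimes>\<^bsub>G\<^esub> mirror a \<otimes>\<^bsub>G\<^esub> mirror v = mirror a"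
proof (rule M.isom_group_eqI)
  fix x assume x: "x \<in> H"
  \<comment> \<open>These two numbers determine how words in the two mirrors move \<open>x\<close>
    along the span of \<open>v\<close> and \<open>a\<close>.\<close>
  define r s where "r = B x v" "s = B x a"
  have av: "B a v = 1/2"
    using va by (simp add: B_commute)
  note simps = mirror_apply v a va av r_s_def[symmetric]
  have 1: "mirror v x = x + (2 * r) *\<^sub>R v"
    using x by (simp add: simps)
  have 2: "mirror a (mirror v x) = x + (2 * r) *\<^sub>R v + (2 * (r + s)) *\<^sub>R a"
    using mirror_in_H[OF v x] unfolding 1 by (simp add: simps algebra_simps)
  have H2: "mirror a (mirror v x) \<in> H"
    using mirror_in_H v a x by blast
  have 3: "mirror v (mirror a (mirror v x)) = x + (2 * (r + s)) *\<^sub>R v + (2 * (r + s)) *\<^sub>R a"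
    using H2 unfolding 2 by (simp add: simps algebra_simps)
  have H3: "mirror v (mirror a (mirror v x)) \<in> H"
    using mirror_in_H[OF v H2] .
  have 4: "mirror a (mirror v (mirror a (mirror v x))) = x + (2 * (r + s)) *\<^sub>R v + (2 * s) *\<^sub>R a"
    using H3 unfolding 3 by (simp add: simps algebra_simps)
  have H4: "mirror a (mirror v (mirror a (mirror v x))) \<in> H"
    using mirror_in_H[OF a H3] .
  have "mirror v (mirror a (mirror v (mirror a (mirror v x)))) = x + (2 * s) *\<^sub>R a"
    using H4 unfolding 4 by (simp add: simps algebra_simps)
  also have "\<dots> = mirror a x"
    using x by (simp add: simps)
  finally show "(mirror v \<otimes>\<^bsub>G\<^esub> mirror a \<otimes>\<^bsub>G\<^esub> mirror v \<otimes>\<^bsub>G\<^esub> mirror a \<otimes>\<^bsub>G\<^esub> mirror v) x = mirror a x"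
    using x mirror_in_H[OF v x] H2 H3 H4 v a by (simp add: mirror_in_G)
qed (use v a in \<open>simp_all add: mirror_in_G\<close>)

text \<open>Any two distinct points are exchanged by the reflection in their normalised
  difference.\<close>

lemma transitive:
  assumes "x \<in> H"
  obtains k where "k \<in> carrier G" "k (e 0) = x"
proof (cases "x = e 0")
  case True
  then show ?thesis
    using that[of "\<one>\<^bsub>G\<^esub>"] by simp
next
  case False
  define c where "c = B x (e 0)"
  have c: "c > 1"
    using False B_ge_1[OF assms, of "e 0"] B_eq_1_imp_eq[OF assms, of "e 0"]
    by (auto simp: c_def order_less_le)
  \<comment> \<open>Normalises \<open>x - e 0\<close>, whose value under \<open>B\<close> is
    \<open>2 - 2 * c\<close>.\<close>
  define r where "r = 1 / sqrt (2 * c - 2)"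
  define w where "w = r *\<^sub>R (x - e 0)"
  have 1: "B x x = 1" "B (e 0) (e 0) = 1" "B (e 0) x = c" "B x (e 0) = c"
    using assms basis0_in_H by (auto simp: H_iff c_def B_commute)
  have "r\<^sup>2 * (2 * c - 2) = 1"
    using c by (simp add: r_def power_divide)
  then have r: "r * r * (2 * c - 2) = 1"
    by (simp add: power2_eq_square)
  have "B w w = - (r * r * (2 * c - 2))"
    by (simp add: w_def 1 algebra_simps)
  then have "B w w = -1"
    by (simp add: r)
  moreover have "mirror w (e 0) = x"
  proof -
    have "mirror w (e 0) = e 0 + (2 * (r * (c - 1)) * r) *\<^sub>R (x - e 0)"
      by (simp add: mirror_apply w_def 1)
    also have "2 * (r * (c - 1)) * r = r * r * (2 * c - 2)"
      by (simp add: algebra_simps)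
    finally show ?thesis
      by (simp add: r)
  qed
  ultimately show ?thesis
    using that mirror_in_G by blast
qed

text \<open>By \<open>dH_less_iff\<close>, being close to \<open>mirror v x\<close> is a strict
  inequality for a norm-continuous function of the reflecting vector.\<close>

lemma continuous_map_mirror:
  "continuous_map (top_of_set {v. B v v = -1}) T mirror"
  unfolding M.continuous_map_pointwise_topology M.continuous_map_to_metric
proof (intro conjI ballI allI impI)
  fix x v \<epsilon>
  assume x: "x \<in> H" and v: "v \<in> topspace (top_of_set {v. B v v = -1})" and \<epsilon>: "0 < (\<epsilon>::real)"
  have v: "B v v = -1"
    using v by simp
  define f where "f = (\<lambda>w. B (mirror v x) (x + (2 * B x w) *\<^sub>R w))"
  define U where "U = {v. B v v = -1} \<inter> f -` {..<cosh \<epsilon>}"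
  have "continuous_on UNIV f"
    unfolding f_def B_def by (intro continuous_intros)
  then have "openin (top_of_set {v. B v v = -1}) U"
    unfolding U_def
    by (intro continuous_openin_preimage_gen) (auto intro: continuous_on_subset)
  moreover have "v \<in> U"
    using v x \<epsilon> mirror_in_H[OF v x] cosh_real_strict_mono[of 0 \<epsilon>]
    by (simp add: U_def f_def H_iff flip: mirror_apply)
  moreover have "mirror w x \<in> M.mball (mirror v x) \<epsilon>" if "w \<in> U" for w
    using that v x \<epsilon> mirror_in_H by (simp add: U_def f_def dH_less_iff flip: mirror_apply)
  ultimately show "\<exists>U. openin (top_of_set {v. B v v = -1}) U \<and> v \<in> U \<and>
      (\<forall>w\<in>U. mirror w x \<in> M.mball (mirror v x) \<epsilon>)"
    by blast
qed (auto simp: mirror_in_G)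

text \<open>Otherwise there are unit vectors \<open>z n\<close> outside the claim, orthogonal to
  ever more basis vectors. They tend weakly to 0, so their mirrors tend pointwise to the
  identity.\<close>

lemma mirror_in_neighbourhood:
  assumes U: "openin T U" "\<one>\<^bsub>G\<^esub> \<in> U"
  obtains n where "n > 0"
    "\<And>z. norm z = 1 \<Longrightarrow> (\<And>i. i < n \<Longrightarrow> z \<bullet> e i = 0) \<Longrightarrow> mirror z \<in> U"
proof (rule ccontr)
  assume "\<not> thesis"
  \<comment> \<open>With \<open>Suc n\<close> the vector is always orthogonal to \<open>e 0\<close>,
    so \<open>B\<close> is minus the inner product against it.\<close>
  then have "\<forall>n. \<exists>z. norm z = 1 \<and> (\<forall>i<Suc n. z \<bullet> e i = 0) \<and> mirror z \<notin> U"
    using that by (metis zero_less_Suc)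
  then obtain z where z: "\<And>n. norm (z n) = 1" "\<And>n i. i < Suc n \<Longrightarrow> z n \<bullet> e i = 0"
    "\<And>n. mirror (z n) \<notin> U"
    by metis
  have Bz: "B x (z n) = - (x \<bullet> z n)" for n x
    using z(2)[of 0 n] by (simp add: B_def)
  have z1: "B (z n) (z n) = -1" for n
    using z(1)[of n] by (simp add: Bz norm_eq_1)
  have "limitin T (\<lambda>n. mirror (z n)) \<one>\<^bsub>G\<^esub> sequentially"
    unfolding M.limitin_pointwise_topology
  proof (intro conjI ballI)
    fix x assume x: "x \<in> H"
    have "(\<lambda>n. x \<bullet> z n) \<longlonglongrightarrow> 0"
    proof (rule Lim_null_comparison)
      have "norm (x \<bullet> z n) \<le> norm (head n x - x)" for n
      proof -
        have "head n x \<bullet> z n = 0"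
          using z(2) by (simp add: head_inner)
        then have "\<bar>x \<bullet> z n\<bar> = \<bar>(head n x - x) \<bullet> z n\<bar>"
          by (simp add: inner_diff_left)
        also have "\<dots> \<le> norm (head n x - x) * norm (z n)"
          by (rule Cauchy_Schwarz_ineq2)
        finally show ?thesis
          by (simp add: z)
      qed
      then show "\<forall>\<^sub>F n in sequentially. norm (x \<bullet> z n) \<le> norm (head n x - x)"
        by simp
      show "(\<lambda>n. norm (head n x - x)) \<longlonglongrightarrow> 0"
        using head_tendsto[of x] by (simp add: LIM_zero tendsto_norm_zero)
    qed
    then have lim: "(\<lambda>n. 1 + 2 * (x \<bullet> z n)\<^sup>2) \<longlonglongrightarrow> 1 + 2 * 0\<^sup>2"
      by (intro tendsto_intros)
    show "limitin M.mtopology (\<lambda>n. mirror (z n) x) (\<one>\<^bsub>G\<^esub> x) sequentially"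
      unfolding M.limitin_metric
    proof (intro conjI allI impI)
      fix \<epsilon> :: real assume \<epsilon>: "\<epsilon> > 0"
      then have "\<forall>\<^sub>F n in sequentially. 1 + 2 * (x \<bullet> z n)\<^sup>2 < cosh \<epsilon>"
        using cosh_real_strict_mono[of 0 \<epsilon>] by (intro order_tendstoD(2)[OF lim]) simp
      moreover have "B (mirror (z n) x) x = 1 + 2 * (x \<bullet> z n)\<^sup>2" for n
        using x by (simp add: mirror_apply H_iff Bz B_commute[of "z n" x] power2_eq_square)
      then have "mirror (z n) x \<in> H"
        "dH (mirror (z n) x) x < \<epsilon> \<longleftrightarrow> 1 + 2 * (x \<bullet> z n)\<^sup>2 < cosh \<epsilon>" for n
        using mirror_in_H[OF z1 x, of n] x \<epsilon>
        by (simp_all add: dH_less_iff)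
      ultimately show "\<forall>\<^sub>F n in sequentially. mirror (z n) x \<in> H \<and>
          dH (mirror (z n) x) (\<one>\<^bsub>G\<^esub> x) < \<epsilon>"
        using x by simp
    qed (use x in simp)
  qed (simp_all add: mirror_in_G z1)
  then have "\<forall>\<^sub>F n in sequentially. mirror (z n) \<in> U"
    using U by (simp add: limitin_def)
  then show False
    using z(3) by simp
qed

text \<open>For a vector \<open>v\<close> of norm \<open>-1\<close> with large zeroth coordinate, a vector \<open>a\<close> of norm \<open>-1\<close> with
  \<open>B v a = 1/2\<close> can be found in a compact set: take it in the span of \<open>e 0\<close> and a unit vector
  of the plane of \<open>e 1, e 2\<close> orthogonal to \<open>v\<close>.\<close>

lemma compact_braid_partners:
  assumes \<eta>: "\<eta> > 0"
  obtains K where "compact K" "K \<subseteq> {a. B a a = -1}"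
    "\<And>v. \<eta> \<le> \<bar>v \<bullet> e 0\<bar> \<Longrightarrow> \<exists>a\<in>K. B v a = 1/2"
proof
  \<comment> \<open>The square root makes \<open>B a a = -1\<close> for every \<open>p\<close> and
    every unit vector \<open>w\<close> of the plane.\<close>
  define f where "f = (\<lambda>(p, w). p *\<^sub>R e 0 + sqrt (1 + p\<^sup>2) *\<^sub>R (fst w *\<^sub>R e 1 + snd w *\<^sub>R e 2))"
  define P where "P = {- 1 / (2 * \<eta>)..1 / (2 * \<eta>)} \<times> sphere (0 :: real \<times> real) 1"
  have "compact P"
    unfolding P_def by (intro compact_Times) auto
  moreover have "continuous_on P f"
    unfolding f_def case_prod_unfold by (intro continuous_intros)
  ultimately show "compact (f ` P)"
    by (rule compact_continuous_image[rotated])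
  show "f ` P \<subseteq> {a. B a a = -1}"
  proof clarsimp
    fix p s t assume "(p, s, t) \<in> P"
    then have st: "s\<^sup>2 + t\<^sup>2 = 1"
      by (simp add: P_def norm_Pair)
    have "B (f (p, s, t)) (f (p, s, t)) = p\<^sup>2 - (sqrt (1 + p\<^sup>2))\<^sup>2 * (s\<^sup>2 + t\<^sup>2)"
      by (simp add: f_def B_def inner_left_distrib inner_right_distrib power2_eq_square
          algebra_simps)
    then show "B (f (p, s, t)) (f (p, s, t)) = -1"
      by (simp add: st)
  qed
  fix v assume v: "\<eta> \<le> \<bar>v \<bullet> e 0\<bar>"
  have "\<exists>s t. s\<^sup>2 + t\<^sup>2 = 1 \<and> s * x + t * y = 0" for x y :: real
  proof (cases "x = 0 \<and> y = 0")
    case True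
    then show ?thesis
      by (intro exI[of _ 1] exI[of _ 0]) simp
  next
    case False
    define r where "r = sqrt (x\<^sup>2 + y\<^sup>2)"
    have "r\<^sup>2 = x\<^sup>2 + y\<^sup>2" "r \<noteq> 0"
      using False by (auto simp: r_def add_nonneg_eq_0_iff)
    moreover have "(y / r)\<^sup>2 + (- x / r)\<^sup>2 = (x\<^sup>2 + y\<^sup>2) / r\<^sup>2"
      by (simp add: power_divide add_divide_distrib)
    ultimately have "(y / r)\<^sup>2 + (- x / r)\<^sup>2 = 1 \<and> (y / r) * x + (- x / r) * y = 0"
      by (simp flip: \<open>r\<^sup>2 = _\<close>)
    then show ?thesis
      by blast
  qed
  then obtain s t where st: "s\<^sup>2 + t\<^sup>2 = 1" "s * (v \<bullet> e 1) + t * (v \<bullet> e 2) = 0"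
    by blast
  \<comment> \<open>Forced by \<open>(v \<bullet> e 0) * p = 1/2\<close>; the lower bound on the
    zeroth coordinate of \<open>v\<close> keeps \<open>p\<close> in a compact interval.\<close>
  define p where "p = 1 / (2 * (v \<bullet> e 0))"
  have "\<bar>p\<bar> \<le> 1 / (2 * \<eta>)"
    using v \<eta> by (simp add: p_def field_simps)
  then have "(p, s, t) \<in> P"
    using st by (auto simp: P_def norm_Pair)
  moreover have "B v (f (p, s, t)) = (v \<bullet> e 0) * p - sqrt (1 + p\<^sup>2) * (s * (v \<bullet> e 1) + t * (v \<bullet> e 2))"
    by (simp add: f_def B_def inner_left_distrib inner_right_distrib algebra_simps)
  moreover have "(v \<bullet> e 0) * p = 1/2"
    using v \<eta> by (simp add: p_def)
  ultimately show "\<exists>a\<in>f ` P. B v a = 1/2"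
    using st by force
qed

text \<open>A product of reflections in the pairwise orthogonal vectors
  \<open>e i - e (n + i)\<close>. It carries the coordinates \<open>1, ..., n - 1\<close> into the
  tail from \<open>n\<close> on, where \<open>tail_small\<close> controls them.\<close>

lemma exists_swap:
  obtains h where "h \<in> carrier G" "h (e 0) = e 0" "\<And>x. x \<in> H \<Longrightarrow> h (h x) = x"
    "\<And>x. x \<in> H \<Longrightarrow> h x \<bullet> e 0 = x \<bullet> e 0"
    "\<And>x j. x \<in> H \<Longrightarrow> j \<in> {1..<n} \<Longrightarrow> h x \<bullet> e (n + j) = x \<bullet> e j"
proof -
  define f where "f = (\<lambda>i. e i - e (n + i))"
  \<comment> \<open>The coefficient is \<open>x \<bullet> f i\<close> without a factor 2 because
    \<open>f i \<bullet> f i = 2\<close>. Starting at 1 leaves \<open>e 0\<close> fixed.\<close>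
  define k where "k = (\<lambda>x. x - (\<Sum>i=1..<n. (x \<bullet> f i) *\<^sub>R f i))"
  have ff: "f i \<bullet> f j = (if i = j then 2 else 0)" if "i \<in> {1..<n}" "j \<in> {1..<n}" for i j
    using that by (auto simp: f_def inner_diff)
  have k_inner: "k x \<bullet> y = x \<bullet> y - (\<Sum>i=1..<n. (x \<bullet> f i) * (f i \<bullet> y))" for x y
    by (simp add: k_def inner_diff_left inner_sum_left)
  have kf: "k x \<bullet> f j = - (x \<bullet> f j)" if "j \<in> {1..<n}" for x j
  proof -
    have "(\<Sum>i=1..<n. (x \<bullet> f i) * (f i \<bullet> f j)) = (\<Sum>i=1..<n. if i = j then 2 * (x \<bullet> f i) else 0)"
      using that by (intro sum.cong) (simp_all add: ff)
    then show ?thesis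
      using that by (simp add: k_inner)
  qed
  have kk: "k (k x) = x" for x
  proof -
    have "(\<Sum>i=1..<n. (k x \<bullet> f i) *\<^sub>R f i) = - (\<Sum>i=1..<n. (x \<bullet> f i) *\<^sub>R f i)"
      by (simp add: kf flip: sum_negf)
    then have "k (k x) = k x + (\<Sum>i=1..<n. (x \<bullet> f i) *\<^sub>R f i)"
      by (subst k_def) simp
    then show ?thesis
      by (simp add: k_def)
  qed
  have k_iso: "k x \<bullet> k y = x \<bullet> y" for x y
  proof -
    define c where "c = (\<Sum>i=1..<n. (x \<bullet> f i) * (y \<bullet> f i))"
    have "(\<Sum>i=1..<n. (x \<bullet> f i) * (f i \<bullet> k y)) = (\<Sum>i=1..<n. - ((x \<bullet> f i) * (y \<bullet> f i)))"
      by (intro sum.cong) (simp_all add: kf inner_commute[of _ "k y"])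
    then have "k x \<bullet> k y = x \<bullet> k y + c"
      by (simp add: k_inner[of x] c_def sum_negf)
    moreover have "k y \<bullet> x = y \<bullet> x - c"
      unfolding k_inner[of y] c_def by (simp add: inner_commute[of _ x] mult.commute)
    ultimately show ?thesis
      by (simp add: inner_commute)
  qed
  have f0: "f i \<bullet> e 0 = 0" if "i \<in> {1..<n}" for i
    using that by (simp add: f_def inner_diff)
  have k0: "k x \<bullet> e 0 = x \<bullet> e 0" for x
    by (simp add: k_inner f0)
  have kB: "B (k x) (k y) = B x y" for x y
    by (simp add: B_def k0 k_iso)
  have kH: "k x \<in> H" if "x \<in> H" for x
    using that by (simp add: H_iff kB k0)
  have ke: "k x \<bullet> e (n + j) = x \<bullet> e j" if "j \<in> {1..<n}" for x j
  proof -
    have "f i \<bullet> e (n + j) = (if i = j then -1 else 0)" if "i \<in> {1..<n}" for i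
      using that by (auto simp: f_def inner_diff)
    then have "(\<Sum>i=1..<n. (x \<bullet> f i) * (f i \<bullet> e (n + j)))
        = (\<Sum>i=1..<n. if i = j then - (x \<bullet> f i) else 0)"
      by (intro sum.cong) simp_all
    then show ?thesis
      using that by (simp add: k_inner) (simp add: f_def inner_diff)
  qed
  have "k (e 0) = e 0"
    using f0 by (simp add: k_def inner_commute[of "e 0"])
  moreover have "restrict k H \<in> carrier G"
  proof (rule isomI)
    show "restrict k H ` H = H"
      using kH kk by (auto simp: image_iff) metis
  qed (simp_all add: kB)
  ultimately show ?thesis
    using that[of "restrict k H"] kk kH k0 ke by simp
qed

subsection \<open>Coarser group topologies\<close>

context
  fixes S :: "('a \<Rightarrow> 'a) topology"
  assumes group_S: "group_topology G S"
    and Hausdorff_S: "Hausdorff_space S"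
    and coarser: "\<And>U. openin S U \<Longrightarrow> openin T U"
begin

section \<open>Continuity of the group operations and of reflections\<close>

lemma topspace_S [simp]: "topspace S = carrier G"
  using group_S by (simp add: group_topology_def)

lemma continuous_map_mult:
  assumes "continuous_map X S f" "continuous_map X S g"
  shows "continuous_map X S (\<lambda>x. f x \<otimes>\<^bsub>G\<^esub> g x)"
proof -
  have "continuous_map X (prod_topology S S) (\<lambda>x. (f x, g x))"
    using assms by (simp add: continuous_map_paired)
  moreover have "continuous_map (prod_topology S S) S (\<lambda>(g, h). g \<otimes>\<^bsub>G\<^esub> h)"
    using group_S by (simp add: group_topology_def)
  ultimately show ?thesis
    using continuous_map_compose by (force simp: o_def)
qed

lemma continuous_map_inv:
  assumes "continuous_map X S f"
  shows "continuous_map X S (\<lambda>x. inv\<^bsub>G\<^esub> (f x))"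
proof -
  have "continuous_map S S (\<lambda>g. inv\<^bsub>G\<^esub> g)"
    using group_S by (simp add: group_topology_def)
  then show ?thesis
    using continuous_map_compose[OF assms] by (force simp: o_def)
qed

lemma continuous_map_mirror_S: "continuous_map (top_of_set {v. B v v = -1}) S mirror"
  using continuous_map_mirror coarser by (auto simp: continuous_map_def)

text \<open>\<open>F\<close> sends the pair of the identity and \<open>a\<close> to the cube of
  \<open>mirror a\<close>, that is \<open>mirror a\<close> itself, which is not the identity. As
  \<open>S\<close> is Hausdorff and \<open>K\<close> compact, the tube lemma yields one
  \<open>V\<close> on which \<open>F\<close> avoids the identity for all \<open>a\<close> in
  \<open>K\<close>. A mirror in \<open>V\<close> with large coordinate would violate this.\<close>

lemma mirror_coord_small:
  assumes \<eta>: "\<eta> > 0"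
  obtains V where "openin S V" "\<one>\<^bsub>G\<^esub> \<in> V"
    "\<And>v. B v v = -1 \<Longrightarrow> mirror v \<in> V \<Longrightarrow> \<bar>v \<bullet> e 0\<bar> < \<eta>"
proof -
  let ?N = "top_of_set {v. B v v = -1}"
  let ?X = "prod_topology S ?N"
  obtain K where K: "compact K" "K \<subseteq> {a. B a a = -1}"
    "\<And>v. \<eta> \<le> \<bar>v \<bullet> e 0\<bar> \<Longrightarrow> \<exists>a\<in>K. B v a = 1/2"
    using compact_braid_partners[OF \<eta>] by blast
  define F where "F = (\<lambda>q. fst q \<otimes>\<^bsub>G\<^esub> mirror (snd q) \<otimes>\<^bsub>G\<^esub> fst q \<otimes>\<^bsub>G\<^esub> mirror (snd q) \<otimes>\<^bsub>G\<^esub> fst q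
    \<otimes>\<^bsub>G\<^esub> mirror (snd q))"
  define W where "W = {q \<in> topspace ?X. F q \<in> carrier G - {\<one>\<^bsub>G\<^esub>}}"
  have c: "continuous_map ?X S fst" "continuous_map ?X S (\<lambda>q. mirror (snd q))"
    using continuous_map_compose[OF continuous_map_snd continuous_map_mirror_S, of S]
    by (simp_all only: continuous_map_fst o_def)
  have "continuous_map ?X S F"
    unfolding F_def by (rule continuous_map_mult c)+
  moreover have "openin S (carrier G - {\<one>\<^bsub>G\<^esub>})"
    using closedin_Hausdorff_singleton[OF Hausdorff_S, of "\<one>\<^bsub>G\<^esub>"]
    by (simp add: closedin_def)
  ultimately have W: "openin ?X W"
    unfolding W_def by (rule openin_continuous_map_preimage)
  have sub: "{\<one>\<^bsub>G\<^esub>} \<times> K \<subseteq> W"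
  proof clarify
    fix a assume "a \<in> K"
    then have a: "B a a = -1"
      using K(2) by blast
    show "(\<one>\<^bsub>G\<^esub>, a) \<in> W"
      by (simp add: W_def F_def a mirror_in_G mirror_mult_mirror mirror_neq_one)
  qed
  have "compactin S {\<one>\<^bsub>G\<^esub>}" "compactin ?N K"
    using K by (simp_all add: compactin_subtopology)
  then obtain V V' where V: "openin S V" "openin ?N V'" "{\<one>\<^bsub>G\<^esub>} \<subseteq> V" "K \<subseteq> V'" "V \<times> V' \<subseteq> W"
    by (rule Wallace_theorem_prod_topology[OF _ _ W sub])
  have "\<bar>v \<bullet> e 0\<bar> < \<eta>" if v: "B v v = -1" "mirror v \<in> V" for v
  proof (rule ccontr)
    assume "\<not> \<bar>v \<bullet> e 0\<bar> < \<eta>"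
    then obtain a where a: "a \<in> K" "B v a = 1/2"
      using K(3)[of v] by (auto simp: not_less)
    then have "B a a = -1"
      using K(2) by blast
    \<comment> \<open>The first five factors equal \<open>mirror a\<close> by the braid relation,
      and the sixth cancels it.\<close>
    then have "F (mirror v, a) = \<one>\<^bsub>G\<^esub>"
      using a v by (simp add: F_def mirror_braid mirror_mult_mirror)
    moreover have "(mirror v, a) \<in> W"
      using a(1) v(2) V(4,5) by blast
    ultimately show False
      by (simp add: W_def)
  qed
  then show thesis
    using that[of V] V(1,3) by simp
qed

text \<open>The tail of \<open>g (e 0)\<close> is tested against its own direction \<open>z\<close>.
  Conjugating \<open>mirror z\<close> by \<open>g\<close> gives a mirror whose zeroth coordinate is,
  up to sign, the norm of the tail, so \<open>mirror_coord_small\<close> bounds it.\<close>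

lemma tail_small:
  assumes \<eta>: "\<eta> > 0"
  obtains V n where "openin S V" "\<one>\<^bsub>G\<^esub> \<in> V" "n > 0"
    "\<And>g. g \<in> V \<Longrightarrow> norm (g (e 0) - head n (g (e 0))) < \<eta>"
proof -
  obtain V0 where V0: "openin S V0" "\<one>\<^bsub>G\<^esub> \<in> V0"
    "\<And>v. B v v = -1 \<Longrightarrow> mirror v \<in> V0 \<Longrightarrow> \<bar>v \<bullet> e 0\<bar> < \<eta>"
    using mirror_coord_small[OF \<eta>] by blast
  let ?X = "prod_topology S S"
  define F where "F = (\<lambda>q. inv\<^bsub>G\<^esub> (fst q) \<otimes>\<^bsub>G\<^esub> snd q \<otimes>\<^bsub>G\<^esub> fst q)"
  have "continuous_map ?X S F"
    unfolding F_def
    by (intro continuous_map_mult continuous_map_inv continuous_map_fst continuous_map_snd)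
  then have "openin ?X {q \<in> topspace ?X. F q \<in> V0}"
    using V0(1) by (rule openin_continuous_map_preimage)
  moreover have "(\<one>\<^bsub>G\<^esub>, \<one>\<^bsub>G\<^esub>) \<in> {q \<in> topspace ?X. F q \<in> V0}"
    using V0(2) by (simp add: F_def)
  \<comment> \<open>Separate neighbourhoods for \<open>g\<close> and for the conjugated mirror:
    \<open>U2\<close> fixes \<open>n\<close> before any \<open>g\<close> in \<open>U1\<close> is
    chosen.\<close>
  ultimately obtain U1 U2 where U: "openin S U1" "openin S U2" "\<one>\<^bsub>G\<^esub> \<in> U1" "\<one>\<^bsub>G\<^esub> \<in> U2"
    "U1 \<times> U2 \<subseteq> {q \<in> topspace ?X. F q \<in> V0}"
    unfolding openin_prod_topology_alt by meson
  obtain n where n: "n > 0"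
    "\<And>z. norm z = 1 \<Longrightarrow> (\<And>i. i < n \<Longrightarrow> z \<bullet> e i = 0) \<Longrightarrow> mirror z \<in> U2"
    using mirror_in_neighbourhood[OF coarser[OF U(2)] U(4)] by blast
  have "norm (g (e 0) - head n (g (e 0))) < \<eta>" if g: "g \<in> U1" for g
  proof (rule ccontr)
    define t where "t = g (e 0) - head n (g (e 0))"
    define z where "z = (1 / norm t) *\<^sub>R t"
    assume "\<not> norm (g (e 0) - head n (g (e 0))) < \<eta>"
    then have t: "\<eta> \<le> norm t" "t \<noteq> 0"
      using \<eta> by (auto simp: t_def)
    have gG: "g \<in> carrier G"
      using g U(1) openin_subset by fastforce
    have z: "z \<bullet> e i = 0" if "i < n" for i
      using that by (simp add: z_def) (simp add: t_def inner_diff_left)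
    have z1: "norm z = 1" "z \<bullet> e 0 = 0"
      using z n(1) t by (simp_all add: z_def)
    then have Bz: "B z x = - (z \<bullet> x)" for x
      by (simp add: B_def)
    have Bzz: "B z z = -1"
      using z1 by (simp add: Bz norm_eq_1)
    obtain v where v: "B v v = -1" "\<And>x. x \<in> H \<Longrightarrow> B v x = B z (g x)"
      "inv\<^bsub>G\<^esub> g \<otimes>\<^bsub>G\<^esub> mirror z \<otimes>\<^bsub>G\<^esub> g = mirror v"
      using mirror_conjugate[OF gG Bzz] by blast
    have "(g, mirror z) \<in> U1 \<times> U2"
      using g n(2) z z1 by simp
    then have "mirror v \<in> V0"
      using U(5) v(3) by (force simp: F_def)
    then have "\<bar>v \<bullet> e 0\<bar> < \<eta>"
      using V0(3) v(1) by blast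
    moreover have "v \<bullet> e 0 = - (z \<bullet> g (e 0))"
      using v(2)[of "e 0"] by (simp add: B_basis0 Bz)
    moreover have "z \<bullet> g (e 0) = norm t"
    proof -
      have "head n (g (e 0)) \<bullet> z = 0"
        using z by (simp add: head_inner)
      then have "z \<bullet> g (e 0) = z \<bullet> t"
        by (simp add: t_def inner_diff_right inner_commute)
      also have "\<dots> = norm t"
        using t by (simp add: z_def dot_square_norm power2_eq_square)
      finally show ?thesis .
    qed
    ultimately show False
      using t by simp
  qed
  then show thesis
    using that U n by blast
qed

text \<open>For \<open>y = g (e 0)\<close>, the coordinates from \<open>n\<close> on are small by
  \<open>tail_small\<close>. Those from 1 to \<open>n - 1\<close> appear in the tail of
  \<open>h y\<close>, the image of \<open>e 0\<close> under the conjugate of \<open>g\<close> by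
  \<open>h\<close>. Since \<open>B y y = 1\<close>, the zeroth coordinate is then close to
  1.\<close>

lemma displacement_small:
  assumes \<epsilon>: "\<epsilon> > 0"
  obtains V where "openin S V" "\<one>\<^bsub>G\<^esub> \<in> V" "\<And>g. g \<in> V \<Longrightarrow> dH (e 0) (g (e 0)) < \<epsilon>"
proof -
  \<comment> \<open>Two sums of squares, each below \<open>\<eta>\<^sup>2\<close>, then raise the
    squared zeroth coordinate from 1 to less than \<open>(cosh \<epsilon>)\<^sup>2\<close>.\<close>
  define \<eta> where "\<eta> = sqrt (((cosh \<epsilon>)\<^sup>2 - 1) / 2)"
  have "cosh \<epsilon> > 1"
    using cosh_real_strict_mono[of 0 \<epsilon>] \<epsilon> by simp
  then have pos: "(cosh \<epsilon>)\<^sup>2 - 1 > 0"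
    by simp
  then have \<eta>: "\<eta> > 0" "2 * \<eta>\<^sup>2 = (cosh \<epsilon>)\<^sup>2 - 1"
    by (simp_all add: \<eta>_def)
  obtain V n where V: "openin S V" "\<one>\<^bsub>G\<^esub> \<in> V" "n > 0"
    "\<And>g. g \<in> V \<Longrightarrow> norm (g (e 0) - head n (g (e 0))) < \<eta>"
    using tail_small[OF \<eta>(1)] by blast
  obtain h where h: "h \<in> carrier G" "h (e 0) = e 0" "\<And>x. x \<in> H \<Longrightarrow> h (h x) = x"
    "\<And>x. x \<in> H \<Longrightarrow> h x \<bullet> e 0 = x \<bullet> e 0"
    "\<And>x j. x \<in> H \<Longrightarrow> j \<in> {1..<n} \<Longrightarrow> h x \<bullet> e (n + j) = x \<bullet> e j"
    using exists_swap[of n] by blast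
  define V' where "V' = V \<inter> {g \<in> carrier G. h \<otimes>\<^bsub>G\<^esub> g \<otimes>\<^bsub>G\<^esub> h \<in> V}"
  have "continuous_map S S (\<lambda>g. h \<otimes>\<^bsub>G\<^esub> g \<otimes>\<^bsub>G\<^esub> h)"
    using h by (intro continuous_map_mult) auto
  then have "openin S V'"
    using V(1) openin_continuous_map_preimage unfolding V'_def by fastforce
  moreover have "h \<otimes>\<^bsub>G\<^esub> h = \<one>\<^bsub>G\<^esub>"
    using h by (intro M.isom_group_eqI) auto
  then have "\<one>\<^bsub>G\<^esub> \<in> V'"
    using V h by (simp add: V'_def)
  moreover have "dH (e 0) (g (e 0)) < \<epsilon>" if g: "g \<in> V'" for g
  proof -
    define y where "y = g (e 0)"
    have gG: "g \<in> carrier G"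
      using g by (simp add: V'_def)
    have y: "y \<in> H" "h y \<in> H"
      using gG h isom_in_H by (auto simp: y_def)
    have tail: "(norm (y - head n y))\<^sup>2 < \<eta>\<^sup>2"
      using V(4)[of g] g \<eta> by (intro power_strict_mono) (auto simp: V'_def y_def)
    have "(h \<otimes>\<^bsub>G\<^esub> g \<otimes>\<^bsub>G\<^esub> h) (e 0) = h y"
      using gG h by (simp add: y_def)
    then have "norm (h y - head n (h y)) < \<eta>"
      using V(4)[of "h \<otimes>\<^bsub>G\<^esub> g \<otimes>\<^bsub>G\<^esub> h"] g by (simp add: V'_def)
    then have "(norm (h y - head n (h y)))\<^sup>2 < \<eta>\<^sup>2"
      by (intro power_strict_mono) auto
    moreover have "(\<Sum>j=1..<n. (y \<bullet> e j)\<^sup>2) \<le> (norm (h y - head n (h y)))\<^sup>2"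
    proof -
      \<comment> \<open>Bessel's inequality for the tail of \<open>h y\<close>, with the coordinates
        \<open>n, ..., 2 * n - 1\<close>.\<close>
      have "0 \<le> (norm (h y - head (n + n) (h y)))\<^sup>2"
        by simp
      also have "\<dots> = (norm (h y - head n (h y)))\<^sup>2 - (\<Sum>i=n..<n+n. (h y \<bullet> e i)\<^sup>2)"
        unfolding norm_diff_head
        using sum.atLeastLessThan_concat[of 0 n "n + n" "\<lambda>i. (h y \<bullet> e i)\<^sup>2"]
        by (simp add: atLeast0LessThan)
      also have "(\<Sum>i=n..<n+n. (h y \<bullet> e i)\<^sup>2) = (\<Sum>j=0..<n. (h y \<bullet> e (n + j))\<^sup>2)"
        using sum.shift_bounds_nat_ivl[of "\<lambda>i. (h y \<bullet> e i)\<^sup>2" 0 n n] by (simp add: add.commute)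
      finally have "(\<Sum>j=0..<n. (h y \<bullet> e (n + j))\<^sup>2) \<le> (norm (h y - head n (h y)))\<^sup>2"
        by simp
      moreover have "(\<Sum>j=1..<n. (y \<bullet> e j)\<^sup>2) = (\<Sum>j=1..<n. (h y \<bullet> e (n + j))\<^sup>2)"
        using h(5) y(1) by simp
      \<comment> \<open>The term \<open>j = 0\<close>, about which \<open>h\<close> gives no
        information, is only a nonnegative surplus.\<close>
      moreover have "\<dots> \<le> (\<Sum>j=0..<n. (h y \<bullet> e (n + j))\<^sup>2)"
        by (intro sum_mono2) auto
      ultimately show ?thesis
        by linarith
    qed
    moreover have "(y \<bullet> e 0)\<^sup>2 = 1 + (norm (y - head n y))\<^sup>2 + (\<Sum>j=1..<n. (y \<bullet> e j)\<^sup>2)"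
    proof -
      have "(\<Sum>j<n. (y \<bullet> e j)\<^sup>2) = (y \<bullet> e 0)\<^sup>2 + (\<Sum>j=1..<n. (y \<bullet> e j)\<^sup>2)"
        using V(3) sum.atLeast_Suc_lessThan[of 0 n "\<lambda>j. (y \<bullet> e j)\<^sup>2"]
        by (simp add: atLeast0LessThan)
      moreover have "2 * (y \<bullet> e 0)\<^sup>2 - (norm y)\<^sup>2 = 1"
        using y(1) by (simp add: H_iff B_def power2_norm_eq_inner) (simp add: power2_eq_square)
      ultimately show ?thesis
        by (simp add: norm_diff_head)
    qed
    ultimately have "(y \<bullet> e 0)\<^sup>2 < (cosh \<epsilon>)\<^sup>2"
      using tail \<eta>(2) by linarith
    then have "B (e 0) y < cosh \<epsilon>"
      using power2_less_imp_less[of "y \<bullet> e 0" "cosh \<epsilon>"] by (simp add: B_basis0)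
    then show ?thesis
      using y(1) \<epsilon> by (simp add: dH_less_iff flip: y_def)
  qed
  ultimately show thesis
    using that by blast
qed

text \<open>Translation by group elements reduces continuity at \<open>g\<close> and
  \<open>x\<close> to the identity and \<open>e 0\<close>.\<close>

lemma continuous_map_orbit:
  assumes x: "x \<in> H"
  shows "continuous_map S M.mtopology (\<lambda>g. g x)"
  unfolding M.continuous_map_to_metric
proof (intro ballI allI impI)
  fix g \<epsilon> assume g: "g \<in> topspace S" and \<epsilon>: "0 < (\<epsilon>::real)"
  obtain V where V: "openin S V" "\<one>\<^bsub>G\<^esub> \<in> V" "\<And>g. g \<in> V \<Longrightarrow> dH (e 0) (g (e 0)) < \<epsilon>"
    using displacement_small[OF \<epsilon>] by blast
  obtain k where k: "k \<in> carrier G" "k (e 0) = x"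
    using transitive[OF x] by blast
  have gG: "g \<in> carrier G"
    using g by simp
  define c where "c = (\<lambda>g'. inv\<^bsub>G\<^esub> (g \<otimes>\<^bsub>G\<^esub> k) \<otimes>\<^bsub>G\<^esub> (g' \<otimes>\<^bsub>G\<^esub> k))"
  define U where "U = {g' \<in> topspace S. c g' \<in> V}"
  have "continuous_map S S c"
    unfolding c_def using k gG by (intro continuous_map_mult) auto
  then have "openin S U"
    unfolding U_def using V(1) by (rule openin_continuous_map_preimage)
  moreover have "g \<in> U"
    using gG k V(2) by (simp add: U_def c_def)
  moreover have "g' x \<in> M.mball (g x) \<epsilon>" if g': "g' \<in> U" for g'
  proof -
    have g'G: "g' \<in> carrier G"
      using g' by (simp add: U_def)
    have gkG: "g \<otimes>\<^bsub>G\<^esub> k \<in> carrier G" and cG: "c g' \<in> carrier G"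
      using gG g'G k by (simp_all add: c_def)
    have in_H: "c g' (e 0) \<in> H" "g' x \<in> H" "g x \<in> H"
      using cG g'G gG x by (auto simp: isom_in_H)
    have "(g \<otimes>\<^bsub>G\<^esub> k) (c g' (e 0)) = g' x"
    proof -
      have "(g \<otimes>\<^bsub>G\<^esub> k) \<otimes>\<^bsub>G\<^esub> c g' = g' \<otimes>\<^bsub>G\<^esub> k"
        using gG g'G k by (simp add: c_def flip: G.m_assoc)
      then show ?thesis
        using M.isom_group_mult[OF gkG cG, of "e 0"] g'G k by simp
    qed
    moreover have "(g \<otimes>\<^bsub>G\<^esub> k) (e 0) = g x"
      using gG k by simp
    ultimately have "dH (g x) (g' x) = dH (e 0) (c g' (e 0))"
      using M.isom_groupD(5)[OF gkG basis0_in_H in_H(1)] by simp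
    also have "\<dots> < \<epsilon>"
      using g' V(3) by (simp add: U_def)
    finally show ?thesis
      using in_H by simp
  qed
  ultimately show "\<exists>U. openin S U \<and> g \<in> U \<and> (\<forall>g'\<in>U. g' x \<in> M.mball (g x) \<epsilon>)"
    by blast
qed

text \<open>\<open>T\<close> is the initial topology for the orbit maps, so their continuity for
  \<open>S\<close> makes the identity map from \<open>S\<close> to \<open>T\<close>
  continuous.\<close>

lemma coarser_eq_pointwise: "S = T"
proof -
  have "continuous_map S T id"
    using continuous_map_orbit by (simp add: M.continuous_map_pointwise_topology)
  then have "openin S U" if "openin T U" for U
    using openin_continuous_map_preimage[OF _ that, of S id] openin_subset[OF that]
    by (simp add: Collect_conj_eq Int_absorb1)
  then show ?thesis
    using coarser by (metis topology_eq)
qed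

end

end

theorem theorem1p6:
  fixes e :: "nat \<Rightarrow> 'a::{real_inner, banach}"
  assumes "hilbert_basis e"
  shows "minimal_topological_group (hyp_Isom e) (hyp_pointwise_topology e)"
proof -
  interpret hyperbolic_hilbert e
    by unfold_locales fact
  show ?thesis
    unfolding minimal_topological_group_def strictly_coarser_def hyp_Isom_eq
      hyp_pointwise_topology_eq
    using M.group_topology_pointwise M.Hausdorff_pointwise_topology coarser_eq_pointwise by blast
qed

end
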